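(* Let $W$ be a $d$-dimensional $(\mathcal{F}_t)$-Brownian motion on a filtered probability space $(\Omega,\mathcal{F},(\mathcal{F}_t)_{t\ge 0},P)$ satisfying the usual conditions. Let $A=(a_1,\ldots,a_p)\in\mathbb{R}^p$, let $B=(b_{ij})$ be a real $p\times p$ matrix, let $\sigma$ be a real $p\times d$ matrix and let $x_0\in\mathbb{R}^p$. Fix $m\in\{1,\ldots,p\}$ and $c\in\mathbb{R}$, and let $X$ be the unique solution to the Ornstein-Uhlenbeck SDE $$X_t = x_0+\int_0^t B(X_s-A)\,\mathrm{d}s+\sigma W_t,\qquad t\ge 0.$$ Let $Y=(X\mid X^m:=c)$ be the intervened process, and let $Y^{-m}$ be the $(p-1)$-dimensional process obtained by removing the $m$'th coordinate from $Y$. Let $\tilde{B}$ be the submatrix of $B$ obtained by removing the $m$'th row and the $m$'th column of $B$, and assume that $\tilde{B}$ is invertible. Then $Y^{-m}$ solves $$Y^{-m}_t = y_0+\int_0^t \tilde{B}(Y^{-m}_s-\tilde{A})\,\mathrm{d}s+\tilde{\sigma}W_t,\qquad t\ge 0,$$ where $y_0$ is obtained by removing the $m$'th coordinate from $x_0$, $\tilde{\sigma}$ is obtained by removing the $m$'th row of $\sigma$, and $\tilde{A}=\alpha-\tilde{B}^{-1}\beta$, where $\alpha$ is obtained by removing the $m$'th coordinate from $A$, and $\beta$ is obtained by removing the $m$'th coordinate from the vector in $\mathbb{R}^p$ whose $i$'th component is $b_{im}(c-a_m)$.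
   Context: Definition of intervention. Let $Z$ be an $r$-dimensional semimartingale on a filtered probability space satisfying the usual conditions, and let $a$ be a Lipschitz mapping from $\mathbb{R}^p$ to the space of real $p\times r$ matrices. Consider the SDE $$X^i_t = x^i_0+\sum_{j=1}^r\int_0^t a_{ij}(X_{s-})\,\mathrm{d}Z^j_s,\qquad i\le p,$$ which has a pathwise unique solution $X$. For $m\le p$ and $c\in\mathbb{R}$, the $(p-1)$-dimensional intervened SDE arising from the intervention $X^m:=c$ is $$U^i_t = x^i_0+\sum_{j=1}^r\int_0^t b_{ij}(U_{s-})\,\mathrm{d}Z^j_s\quad\text{for } i\le p \text{ with } i\neq m,$$ where $b_{ij}(y_1,\ldots,y_{m-1},y_{m+1},\ldots,y_p)=a_{ij}(y_1,\ldots,y_{m-1},c,y_{m+1},\ldots,y_p)$, with $c$ in the $m$'th coordinate (in this definition $b_{ij}$ denotes coefficient functions, not entries of the matrix $B$). Letting $U$ be the unique solution to this SDE, the intervened process, written $(X\mid X^m:=c)$, is $Y=(U^1,\ldots,U^{m-1},c,U^{m+1},\ldots,U^p)$. The Ornstein-Uhlenbeck SDE $X_t=x_0+\int_0^t B(X_s-A)\,\mathrm{d}s+\sigma W_t$ is regarded as an SDE of this form with $r=d+1$, driving semimartingale $Z_t=(t,W^1_t,\ldots,W^d_t)$, and coefficient $a(x)$ equal to the $p\times(d+1)$ matrix whose first column is $B(x-A)$ and whose remaining $d$ columns are those of $\sigma$. Here $A$ is called the mean reversion level, $B$ the mean reversion speed and $\sigma$ the diffusion matrix. *)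

theory Defs
  imports
    "HOL-Probability.Probability"
    "Jordan_Normal_Form.Gauss_Jordan_Elimination"
    "Jordan_Normal_Form.Determinant"
begin

hide_type (open) Finite_Cartesian_Product.vec
hide_const (open) Finite_Cartesian_Product.vec Finite_Cartesian_Product.vec_nth
no_notation Finite_Cartesian_Product.vec_nth (infixl \<open>$\<close> 90)

text \<open>
  Time is the set of nonnegative reals. Filtrations and processes are families over all of
  the type \<^typ>\<open>real\<close>, but only their members at times \<open>t \<ge> 0\<close> matter: a filtration on
  \<open>[0,\<infinity>)\<close> can be continued by its time-0 member, and for a nonnegative random time
  the conditions at negative times in the definitions of a stopping time and of its
  \<open>\<sigma>\<close>-algebra are void.
  Vectors and matrices are those of \<^theory>\<open>Jordan_Normal_Form.Matrix\<close>, indexed from 0.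
\<close>

definition usual_filtered_prob_space ::
    "'w measure \<Rightarrow> (real \<Rightarrow> 'w measure) \<Rightarrow> bool" where
  "usual_filtered_prob_space M F \<longleftrightarrow>
     prob_space M \<and> filtration (space M) F \<and> (\<forall>t. sets (F t) \<subseteq> sets M) \<and>
     (\<forall>N\<in>null_sets M. \<forall>N'\<subseteq>N. N' \<in> sets (F 0)) \<and>
     (\<forall>t\<ge>0. (\<Inter>u\<in>{t<..}. sets (F u)) \<subseteq> sets (F t))"

definition cadlag :: "(real \<Rightarrow> real) \<Rightarrow> bool" where
  "cadlag f \<longleftrightarrow>
     (\<forall>t\<ge>0. (f \<longlongrightarrow> f t) (at_right t)) \<and> (\<forall>t>0. \<exists>l. (f \<longlongrightarrow> l) (at_left t))"

definition caglad :: "(real \<Rightarrow> real) \<Rightarrow> bool" where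
  "caglad f \<longleftrightarrow>
     (\<forall>t>0. (f \<longlongrightarrow> f t) (at_left t)) \<and> (\<forall>t\<ge>0. \<exists>l. (f \<longlongrightarrow> l) (at_right t))"

definition adapted_cadlag ::
    "'w measure \<Rightarrow> (real \<Rightarrow> 'w measure) \<Rightarrow> (real \<Rightarrow> 'w \<Rightarrow> real) \<Rightarrow> bool" where
  "adapted_cadlag M F X \<longleftrightarrow>
     (\<forall>t\<ge>0. X t \<in> borel_measurable (F t)) \<and> (AE \<omega> in M. cadlag (\<lambda>t. X t \<omega>))"

text \<open>Values at time 0 are ignored: integrals below are over \<open>(0,t]\<close>.\<close>

definition adapted_caglad ::
    "'w measure \<Rightarrow> (real \<Rightarrow> 'w measure) \<Rightarrow> (real \<Rightarrow> 'w \<Rightarrow> real) \<Rightarrow> bool" where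
  "adapted_caglad M F H \<longleftrightarrow>
     (\<forall>t>0. H t \<in> borel_measurable (F t)) \<and> (AE \<omega> in M. caglad (\<lambda>t. H t \<omega>))"

definition vec_adapted_cadlag ::
    "'w measure \<Rightarrow> (real \<Rightarrow> 'w measure) \<Rightarrow> nat \<Rightarrow> (real \<Rightarrow> 'w \<Rightarrow> real vec) \<Rightarrow> bool" where
  "vec_adapted_cadlag M F n X \<longleftrightarrow>
     (\<forall>t\<ge>0. \<forall>\<omega>\<in>space M. X t \<omega> \<in> carrier_vec n) \<and>
     (\<forall>i<n. adapted_cadlag M F (\<lambda>t \<omega>. X t \<omega> $ i))"

definition brownian_motion ::
    "'w measure \<Rightarrow> (real \<Rightarrow> 'w measure) \<Rightarrow> nat \<Rightarrow> (real \<Rightarrow> 'w \<Rightarrow> real vec) \<Rightarrow> bool" where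
  "brownian_motion M F d W \<longleftrightarrow>
     (\<forall>t\<ge>0. \<forall>\<omega>\<in>space M. W t \<omega> \<in> carrier_vec d) \<and>
     (\<forall>i<d. \<forall>t\<ge>0. (\<lambda>\<omega>. W t \<omega> $ i) \<in> borel_measurable (F t)) \<and>
     (AE \<omega> in M. W 0 \<omega> = 0\<^sub>v d) \<and>
     (AE \<omega> in M. \<forall>i<d. continuous_on {0..} (\<lambda>t. W t \<omega> $ i)) \<and>
     (\<forall>s\<ge>0. \<forall>t>s.
        let R = \<Pi>\<^sub>M i\<in>{..<d}. borel;
            D = (\<lambda>\<omega>. \<lambda>i\<in>{..<d}. W t \<omega> $ i - W s \<omega> $ i)
        in distr M R D =
             (\<Pi>\<^sub>M i\<in>{..<d}. density lborel (\<lambda>x. ennreal (normal_density 0 (sqrt (t - s)) x))) \<and>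
           prob_space.indep_set M (sets (F s)) {D -` E \<inter> space M | E. E \<in> sets R})"

text \<open>
  Stochastic integration as in Protter's book: the integral is the extension, continuous for
  uniform convergence on compacts in probability (ucp), of the elementary integral of simple
  predictable processes to adapted caglad integrands. Integrals are over \<open>(0,t]\<close>, so the
  simple predictable processes have no term at time 0.

  If the underlying space satisfies the usual conditions, all processes compared by \<open>ucp_lim\<close>
  below are adapted with almost surely one-sidedly continuous paths, hence the events in it are
  measurable.
\<close>

definition ucp_lim ::
    "'w measure \<Rightarrow> (nat \<Rightarrow> real \<Rightarrow> 'w \<Rightarrow> real) \<Rightarrow> (real \<Rightarrow> 'w \<Rightarrow> real) \<Rightarrow> bool" where
  "ucp_lim M X Y \<longleftrightarrow>
     (\<forall>t>0. \<forall>\<epsilon>>0.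
        (\<lambda>n. measure M {\<omega>\<in>space M. \<exists>s\<in>{0<..t}. \<epsilon> < \<bar>X n s \<omega> - Y s \<omega>\<bar>}) \<longlonglongrightarrow> 0)"

text \<open>
  A triple \<open>(n, T, K)\<close> stands for the process
  \<open>K\<^sub>0 1\<^bsub>(T\<^sub>0,T\<^sub>1]\<^esub> + \<dots> + K\<^bsub>n-1\<^esub> 1\<^bsub>(T\<^bsub>n-1\<^esub>,T\<^sub>n]\<^esub>\<close>.
\<close>

type_synonym 'w simple_process = "nat \<times> (nat \<Rightarrow> 'w \<Rightarrow> real) \<times> (nat \<Rightarrow> 'w \<Rightarrow> real)"

fun simple_predictable ::
    "'w measure \<Rightarrow> (real \<Rightarrow> 'w measure) \<Rightarrow> 'w simple_process \<Rightarrow> bool" where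
  "simple_predictable M F (n, T, K) \<longleftrightarrow>
     (\<forall>\<omega>\<in>space M. T 0 \<omega> = 0 \<and> (\<forall>k<n. T k \<omega> \<le> T (Suc k) \<omega>)) \<and>
     (\<forall>k\<le>n. stopping_time F (T k)) \<and>
     (\<forall>k<n. K k \<in> borel_measurable (filtration.pre_sigma (space M) F (T k)))"

fun simple_value :: "'w simple_process \<Rightarrow> real \<Rightarrow> 'w \<Rightarrow> real" where
  "simple_value (n, T, K) t \<omega> = (\<Sum>k<n. K k \<omega> * indicator {T k \<omega><..T (Suc k) \<omega>} t)"

fun simple_integral ::
    "'w simple_process \<Rightarrow> (real \<Rightarrow> 'w \<Rightarrow> real) \<Rightarrow> real \<Rightarrow> 'w \<Rightarrow> real" where
  "simple_integral (n, T, K) Z t \<omega> =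
     (\<Sum>k<n. K k \<omega> * (Z (min (T (Suc k) \<omega>) t) \<omega> - Z (min (T k \<omega>) t) \<omega>))"

definition simple_approx ::
    "'w measure \<Rightarrow> (real \<Rightarrow> 'w measure) \<Rightarrow> (nat \<Rightarrow> 'w simple_process) \<Rightarrow>
     (real \<Rightarrow> 'w \<Rightarrow> real) \<Rightarrow> bool" where
  "simple_approx M F S H \<longleftrightarrow>
     (\<forall>n. simple_predictable M F (S n)) \<and> ucp_lim M (\<lambda>n. simple_value (S n)) H"

text \<open>
  \<open>stoch_integral M F H Z I\<close>: the process \<open>I\<close> is (a version of) the integral of \<open>H\<close> with
  respect to \<open>Z\<close>. For a semimartingale \<open>Z\<close> such an \<open>I\<close> exists for every adapted caglad \<open>H\<close>,
  and it is unique up to indistinguishability.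
\<close>

definition stoch_integral ::
    "'w measure \<Rightarrow> (real \<Rightarrow> 'w measure) \<Rightarrow> (real \<Rightarrow> 'w \<Rightarrow> real) \<Rightarrow>
     (real \<Rightarrow> 'w \<Rightarrow> real) \<Rightarrow> (real \<Rightarrow> 'w \<Rightarrow> real) \<Rightarrow> bool" where
  "stoch_integral M F H Z I \<longleftrightarrow>
     adapted_caglad M F H \<and> adapted_cadlag M F I \<and>
     (\<exists>S. simple_approx M F S H) \<and>
     (\<forall>S. simple_approx M F S H \<longrightarrow> ucp_lim M (\<lambda>n. simple_integral (S n) Z) I)"

definition left_limit :: "nat \<Rightarrow> (real \<Rightarrow> 'w \<Rightarrow> real vec) \<Rightarrow> real \<Rightarrow> 'w \<Rightarrow> real vec" where
  "left_limit n X t \<omega> = vec n (\<lambda>i. Lim (at_left t) (\<lambda>s. X s \<omega> $ i))"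

text \<open>
  \<open>X\<close> solves the \<open>p\<close>-dimensional equation
  \<open>X\<^sup>i\<^sub>t = x\<^sub>0\<^sup>i + \<Sum>j<r. \<integral>\<^sub>0\<^sup>t a\<^sub>i\<^sub>j(X\<^bsub>s-\<^esub>) dZ\<^sup>j\<^sub>s\<close>.
  That \<open>Z\<close> is a semimartingale and \<open>a\<close> is Lipschitz, which ensures existence and pathwise
  uniqueness of the solution, is not part of the predicate.
\<close>

definition sde_solution ::
    "'w measure \<Rightarrow> (real \<Rightarrow> 'w measure) \<Rightarrow> nat \<Rightarrow> nat \<Rightarrow> (real vec \<Rightarrow> real mat) \<Rightarrow>
     (real \<Rightarrow> 'w \<Rightarrow> real vec) \<Rightarrow> real vec \<Rightarrow> (real \<Rightarrow> 'w \<Rightarrow> real vec) \<Rightarrow> bool" where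
  "sde_solution M F p r a Z x0 X \<longleftrightarrow>
     vec_adapted_cadlag M F p X \<and>
     (\<exists>I. (\<forall>i<p. \<forall>j<r.
             stoch_integral M F (\<lambda>t \<omega>. a (left_limit p X t \<omega>) $$ (i, j))
               (\<lambda>t \<omega>. Z t \<omega> $ j) (I i j)) \<and>
          (AE \<omega> in M. \<forall>t\<ge>0. \<forall>i<p. X t \<omega> $ i = x0 $ i + (\<Sum>j<r. I i j t \<omega>)))"

definition vec_delete :: "nat \<Rightarrow> 'a vec \<Rightarrow> 'a vec" where
  "vec_delete m v = vec (dim_vec v - 1) (\<lambda>i. v $ insert_index m i)"

definition vec_insert :: "nat \<Rightarrow> 'a \<Rightarrow> 'a vec \<Rightarrow> 'a vec" where
  "vec_insert m c v =
     vec (Suc (dim_vec v)) (\<lambda>i. if i = m then c else v $ delete_index m i)"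

definition mat_delete_row :: "nat \<Rightarrow> 'a mat \<Rightarrow> 'a mat" where
  "mat_delete_row m A = mat (dim_row A - 1) (dim_col A) (\<lambda>(i, j). A $$ (insert_index m i, j))"

definition intervened_coeff ::
    "(real vec \<Rightarrow> real mat) \<Rightarrow> nat \<Rightarrow> real \<Rightarrow> real vec \<Rightarrow> real mat" where
  "intervened_coeff a m c y = mat_delete_row m (a (vec_insert m c y))"

text \<open>
  \<open>Y\<close> is the process \<open>(X | X\<^sup>m := c)\<close>. The intervention is an operation on the equation that
  \<open>X\<close> solves, so it depends on the coefficient \<open>a\<close>, the driving process \<open>Z\<close> and the initial
  value \<open>x0\<close> rather than on \<open>X\<close> itself.
\<close>

definition intervened_process ::
    "'w measure \<Rightarrow> (real \<Rightarrow> 'w measure) \<Rightarrow> nat \<Rightarrow> nat \<Rightarrow> (real vec \<Rightarrow> real mat) \<Rightarrow>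
     (real \<Rightarrow> 'w \<Rightarrow> real vec) \<Rightarrow> real vec \<Rightarrow> nat \<Rightarrow> real \<Rightarrow> (real \<Rightarrow> 'w \<Rightarrow> real vec) \<Rightarrow> bool" where
  "intervened_process M F p r a Z x0 m c Y \<longleftrightarrow>
     (\<exists>U. sde_solution M F (p - 1) r (intervened_coeff a m c) Z (vec_delete m x0) U \<and>
          (\<forall>t\<ge>0. \<forall>\<omega>\<in>space M. Y t \<omega> = vec_insert m c (U t \<omega>)))"

definition ou_solution ::
    "'w measure \<Rightarrow> (real \<Rightarrow> 'w measure) \<Rightarrow> nat \<Rightarrow> real vec \<Rightarrow> real mat \<Rightarrow> real mat \<Rightarrow>
     (real \<Rightarrow> 'w \<Rightarrow> real vec) \<Rightarrow> real vec \<Rightarrow> (real \<Rightarrow> 'w \<Rightarrow> real vec) \<Rightarrow> bool" where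
  "ou_solution M F p A B \<sigma> W x0 X \<longleftrightarrow>
     vec_adapted_cadlag M F p X \<and>
     (AE \<omega> in M. \<forall>t\<ge>0.
        X t \<omega> = x0 + vec p (\<lambda>i. LBINT s:{0..t}. (B *\<^sub>v (X s \<omega> - A)) $ i) + \<sigma> *\<^sub>v W t \<omega>)"

definition ou_coeff :: "real vec \<Rightarrow> real mat \<Rightarrow> real mat \<Rightarrow> real vec \<Rightarrow> real mat" where
  "ou_coeff A B \<sigma> x = mat_of_cols (dim_row B) ((B *\<^sub>v (x - A)) # cols \<sigma>)"

definition ou_driver :: "(real \<Rightarrow> 'w \<Rightarrow> real vec) \<Rightarrow> real \<Rightarrow> 'w \<Rightarrow> real vec" where
  "ou_driver W t \<omega> = vCons t (W t \<omega>)"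

end

theory Submission
  imports Defs
begin

text \<open>
  Deleting row \<open>m\<close> of the coefficient and putting \<open>c\<close> for the coordinate \<open>m\<close> leaves the
  diffusion part as a matrix of constants, and turns the drift into
  \<open>B\<^sub>t (u - \<alpha>) + \<beta>\<close>, where \<open>B\<^sub>t\<close> is the reduced matrix (\<open>mult_vec_insert_index\<close>): the fixed
  coordinate contributes only the constant \<open>\<beta>\<close>. As \<open>B\<^sub>t\<close> is invertible, \<open>\<beta>\<close> can be absorbed
  into the mean reversion level, and the drift is \<open>B\<^sub>t (u - A\<^sub>t)\<close> (\<open>affine_drift_recentered\<close>).
  Algebraically this is the whole argument.

  What remains is to recognise the stochastic integrals of the intervened equation, which are
  characterised as ucp limits of elementary integrals, as the terms of the Ornstein-Uhlenbeck
  equation. Only two kinds occur. An integral with respect to the time coordinate of the driver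
  is a pathwise Lebesgue integral (\<open>stoch_integral_wrt_time\<close>), and the integral of a constant is a
  multiple of the increment of the integrator (\<open>stoch_integral_const\<close>), which for the Brownian
  coordinates is a multiple of \<open>W\<close> because \<open>W\<close> starts at \<open>0\<close>. In both cases almost every path
  admits, for every precision, one simple integrand that is close to the integrand and whose
  elementary integral is close to the stochastic integral (\<open>stoch_integral_AE_approx\<close>); the
  elementary integrals can be computed explicitly, which identifies the limit on that path.

  The integrand of the time integral is evaluated at left limits, the one in the
  Ornstein-Uhlenbeck equation at the process itself. A path with one-sided limits everywhere has
  only countably many discontinuities (\<open>regulated_countable_discontinuities\<close>), so the two Lebesgue
  integrals agree. The same fact makes paths measurable in time.
\<close>

section \<open>Functions with one-sided limits\<close>

text \<open>
  For a fixed \<open>e\<close>, the points at which \<open>f\<close> oscillates by at least \<open>e\<close> do not accumulate: the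
  one-sided limits at \<open>y\<close> make \<open>f\<close> almost constant just to the left and just to the right of \<open>y\<close>.
  Hence they form a sparse set, which is countable, and a discontinuity is a point of
  oscillation at least \<open>1 / (n + 1)\<close> for some \<open>n\<close>.
\<close>

lemma regulated_countable_discontinuities:
  fixes f :: "real \<Rightarrow> real"
  assumes left: "\<And>t. t > a \<Longrightarrow> \<exists>l. (f \<longlongrightarrow> l) (at_left t)"
    and right: "\<And>t. t > a \<Longrightarrow> \<exists>l. (f \<longlongrightarrow> l) (at_right t)"
  shows "countable {t. a < t \<and> \<not> isCont f t}"
proof -
  define small where "small e t \<longleftrightarrow> (\<exists>S. open S \<and> t \<in> S \<and> (\<forall>u\<in>S. \<forall>v\<in>S. \<bar>f u - f v\<bar> < e))" for e t
  have small_interval: "small e x"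
    if "x \<in> {b<..<c}" "\<And>u. u \<in> {b<..<c} \<Longrightarrow> \<bar>f u - L\<bar> < e / 2" for e x b c and L :: real
    unfolding small_def
  proof (intro exI[of _ "{b<..<c}"] conjI ballI)
    fix u v assume "u \<in> {b<..<c}" "v \<in> {b<..<c}"
    with that(2)[of u] that(2)[of v] show "\<bar>f u - f v\<bar> < e" by linarith
  qed (use that in auto)
  have countable_large: "countable ({a<..} \<inter> {t. \<not> small e t})" if "e > 0" for e
  proof (rule sparse_imp_countable)
    show "{t. \<not> small e t} sparse_in {a<..}"
      unfolding sparse_in_open[OF open_greaterThan]
    proof
      fix y assume "y \<in> {a<..}"
      then obtain l r where l: "(f \<longlongrightarrow> l) (at_left y)" and r: "(f \<longlongrightarrow> r) (at_right y)"
        using left[of y] right[of y] by auto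
      obtain b where b: "b < y" "\<And>u. b < u \<Longrightarrow> u < y \<Longrightarrow> \<bar>f u - l\<bar> < e / 2"
        using tendstoD[OF l, of "e/2"] \<open>e > 0\<close>
        by (auto simp: dist_real_def eventually_at_left[of "y - 1"])
      obtain c where c: "y < c" "\<And>u. y < u \<Longrightarrow> u < c \<Longrightarrow> \<bar>f u - r\<bar> < e / 2"
        using tendstoD[OF r, of "e/2"] \<open>e > 0\<close>
        by (auto simp: dist_real_def eventually_at_right[of _ "y + 1"])
      have "eventually (\<lambda>x. x \<in> {b<..<y}) (at_left y)" "eventually (\<lambda>x. x \<in> {y<..<c}) (at_right y)"
        using b(1) c(1) eventually_at_left_real eventually_at_right_real by blast+
      then have "eventually (small e) (at_left y)" "eventually (small e) (at_right y)"
        using small_interval[of _ b y l e] small_interval[of _ y c r e] b(2) c(2)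
        by (auto elim!: eventually_mono)
      then show "\<not> y islimpt {t. \<not> small e t}"
        by (simp add: islimpt_iff_eventually eventually_at_split)
    qed
  qed simp
  have "{t. a < t \<and> \<not> isCont f t} \<subseteq> (\<Union>n. {a<..} \<inter> {t. \<not> small (inverse (Suc n)) t})"
  proof safe
    fix t assume t: "a < t" "\<not> isCont f t"
    show "t \<in> (\<Union>n. {a<..} \<inter> {t. \<not> small (inverse (Suc n)) t})"
    proof (rule ccontr)
      assume "\<not> ?thesis"
      then have sm: "small (inverse (Suc n)) t" for n using t by auto
      have "(f \<longlongrightarrow> f t) (at t)"
      proof (rule tendstoI)
        fix e :: real assume "e > 0"
        then obtain n where n: "inverse (Suc n) < e" using reals_Archimedean by blast
        obtain S where "open S" "t \<in> S" "\<And>u v. u \<in> S \<Longrightarrow> v \<in> S \<Longrightarrow> \<bar>f u - f v\<bar> < inverse (Suc n)"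
          using sm[of n] unfolding small_def by blast
        then show "eventually (\<lambda>x. dist (f x) (f t) < e) (at t)"
          unfolding eventually_at_topological dist_real_def using n by (meson order.strict_trans)
      qed
      with t show False by (simp add: isCont_def)
    qed
  qed
  moreover have "countable (\<Union>n. {a<..} \<inter> {t. \<not> small (inverse (Suc n)) t})"
    by (intro countable_UN countable_large) auto
  ultimately show ?thesis by (rule countable_subset)
qed

lemma cadlag_countable_discontinuities:
  "cadlag f \<Longrightarrow> countable {t. 0 < t \<and> \<not> isCont f t}"
  unfolding cadlag_def by (rule regulated_countable_discontinuities) (auto intro: less_imp_le)

lemma caglad_countable_discontinuities:
  "caglad f \<Longrightarrow> countable {t. 0 < t \<and> \<not> isCont f t}"
  unfolding caglad_def by (rule regulated_countable_discontinuities) (auto intro: less_imp_le)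

text \<open>
  The values of \<open>f\<close> outside \<open>[0, b]\<close> are cut off by the indicator, which adds at most the two
  discontinuities \<open>0\<close> and \<open>b\<close>.
\<close>

lemma set_borel_measurable_countable_discontinuities:
  fixes f :: "real \<Rightarrow> real"
  assumes "countable {t. 0 < t \<and> \<not> isCont f t}"
  shows "set_borel_measurable lborel {0..b} f"
proof -
  let ?D = "{t. 0 < t \<and> \<not> isCont f t}"
  let ?g = "\<lambda>s. indicator {0..b} s *\<^sub>R f s"
  have "isCont ?g t" if t: "t \<notin> insert 0 (insert b ?D)" for t
  proof (cases "0 < t \<and> t < b")
    case True
    have "eventually (\<lambda>s. ?g s = f s) (nhds t)"
      using True by (intro eventually_nhds_in_open[THEN eventually_mono, of "{0<..<b}"])
        (auto simp: indicator_def)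
    then have "isCont ?g t \<longleftrightarrow> isCont f t" by (rule isCont_cong)
    then show ?thesis using True t by simp
  next
    case False
    have "eventually (\<lambda>s. ?g s = 0) (nhds t)"
      using False t by (intro eventually_nhds_in_open[THEN eventually_mono, of "- {0..b}"])
        (auto simp: indicator_def)
    then have "isCont ?g t \<longleftrightarrow> isCont (\<lambda>_. 0 :: real) t" by (rule isCont_cong)
    then show ?thesis by simp
  qed
  then have "continuous_on (- insert 0 (insert b ?D)) ?g"
    by (intro continuous_at_imp_continuous_on) auto
  then have "?g \<in> borel_measurable borel"
    using assms by (intro borel_measurable_continuous_countable_exceptions[of "insert 0 (insert b ?D)"]) auto
  then show ?thesis by (simp add: set_borel_measurable_def)
qed

section \<open>Elementary integrals with respect to time\<close>

text \<open>
  For the integrator \<open>t\<close>, the Riemann sum that defines the elementary integral is the Lebesgue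
  integral of the step function itself.
\<close>

lemma simple_integral_wrt_time:
  assumes T0: "T 0 \<omega> = 0" and mono: "\<And>k. k < n \<Longrightarrow> T k \<omega> \<le> T (Suc k) \<omega>" and t: "t \<ge> 0"
  shows "set_integrable lborel {0..t} (\<lambda>s. simple_value (n, T, K) s \<omega>)"
    and "(LBINT s:{0..t}. simple_value (n, T, K) s \<omega>) = simple_integral (n, T, K) (\<lambda>t \<omega>. t) t \<omega>"
proof -
  have T: "0 \<le> T k \<omega>" if "k \<le> n" for k
    using that by (induction k) (auto simp: T0 Suc_le_eq intro: order_trans[OF _ mono])
  let ?J = "\<lambda>k. {min (T k \<omega>) t<..min (T (Suc k) \<omega>) t}"
  have split: "indicator {0..t} s *\<^sub>R simple_value (n, T, K) s \<omega> = (\<Sum>k<n. K k \<omega> * indicator (?J k) s)"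
    for s :: real
    unfolding simple_value.simps sum_distrib_left real_scaleR_def
  proof (rule sum.cong[OF refl])
    fix k assume "k \<in> {..<n}"
    then have "0 \<le> T k \<omega>" "T k \<omega> \<le> T (Suc k) \<omega>" using T mono by auto
    then show "indicator {0..t} s * (K k \<omega> * indicator {T k \<omega><..T (Suc k) \<omega>} s) = K k \<omega> * indicator (?J k) s"
      by (auto simp: indicator_def)
  qed
  have J: "integrable lborel (\<lambda>s. indicator (?J k) s :: real)" for k
    by (cases "min (T k \<omega>) t \<le> min (T (Suc k) \<omega>) t") auto
  have LJ: "integral\<^sup>L lborel (indicator (?J k) :: real \<Rightarrow> real) = min (T (Suc k) \<omega>) t - min (T k \<omega>) t" if "k < n" for k
    using mono[OF that] by (simp add: measure_def min.mono)
  show "set_integrable lborel {0..t} (\<lambda>s. simple_value (n, T, K) s \<omega>)"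
    unfolding set_integrable_def split by (intro Bochner_Integration.integrable_sum integrable_mult_right J)
  show "(LBINT s:{0..t}. simple_value (n, T, K) s \<omega>) = simple_integral (n, T, K) (\<lambda>t \<omega>. t) t \<omega>"
  proof -
    have "(\<integral>s. (\<Sum>k<n. K k \<omega> * indicator (?J k) s) \<partial>lborel) =
        (\<Sum>k<n. K k \<omega> * integral\<^sup>L lborel (indicator (?J k)))"
      by (subst Bochner_Integration.integral_sum) (auto intro: integrable_mult_right J)
    also have "\<dots> = simple_integral (n, T, K) (\<lambda>t \<omega>. t) t \<omega>"
      unfolding simple_integral.simps by (intro sum.cong refl) (simp only: LJ lessThan_iff)
    finally show ?thesis by (simp only: set_lebesgue_integral_def split)
  qed
qed

text \<open>
  The deterministic core of the identification of an integral with respect to time: if step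
  functions come uniformly close to \<open>h\<close> on \<open>(0, t]\<close> while their integrals come close to \<open>x t\<close>,
  then \<open>x t\<close> is the integral of \<open>h\<close>. The value at time \<open>0\<close> is recovered by right continuity,
  because ucp convergence only sees times in \<open>(0, t]\<close>.
\<close>

lemma integral_eq_if_approximable:
  fixes h x :: "real \<Rightarrow> real"
  assumes h: "caglad h" and x: "(x \<longlongrightarrow> x 0) (at_right 0)"
    and approx: "\<And>t e. t > 0 \<Longrightarrow> e > 0 \<Longrightarrow> \<exists>g. set_integrable lborel {0..t} g \<and>
      (\<forall>s\<in>{0<..t}. \<bar>g s - h s\<bar> \<le> e) \<and> \<bar>(LBINT s:{0..t}. g s) - x t\<bar> \<le> e"
    and t: "t \<ge> 0"
  shows "x t = (LBINT s:{0..t}. h s)"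
proof -
  have meas: "set_borel_measurable lborel {0..t} h" for t
    using caglad_countable_discontinuities[OF h] by (rule set_borel_measurable_countable_discontinuities)
  have AE0: "AE s in lborel. s \<noteq> (0::real)"
    by (rule AE_lborel_singleton)
  have const: "set_integrable lborel {0..t} (\<lambda>s. c)" for t c :: real
    unfolding set_integrable_def
    by (intro integrable_scaleR_left integrable_real_indicator) (auto simp: emeasure_lborel_Icc_eq)
  have int: "set_integrable lborel {0..t} h" if "t > 0" for t
  proof -
    note t = that
    obtain g where g: "set_integrable lborel {0..t} g" "\<And>s. s \<in> {0<..t} \<Longrightarrow> \<bar>g s - h s\<bar> \<le> 1"
      using approx[of t 1] t by auto
    show ?thesis
    proof (rule set_integrable_bound[OF _ meas])
      show "set_integrable lborel {0..t} (\<lambda>s. \<bar>g s\<bar> + 1)"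
        using g(1) const by (intro set_integral_add set_integrable_abs)
      show "AE s in lborel. s \<in> {0..t} \<longrightarrow> norm (h s) \<le> norm (\<bar>g s\<bar> + 1)"
        using AE0
      proof eventually_elim
        fix s :: real assume "s \<noteq> 0"
        then show "s \<in> {0..t} \<longrightarrow> norm (h s) \<le> norm (\<bar>g s\<bar> + 1)"
          using g(2)[of s] by auto
      qed
    qed
  qed
  have pos: "x t = (LBINT s:{0..t}. h s)" if "t > 0" for t
  proof -
    have "\<bar>x t - (LBINT s:{0..t}. h s)\<bar> \<le> 0 + e" if "e > 0" for e
    proof -
      \<comment> \<open>one error \<open>e'\<close> from \<open>x t\<close> to the integral of \<open>g\<close>, and \<open>e' * t\<close> from there to that of \<open>h\<close>\<close>
      define e' where "e' = e / (1 + t)"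
      have "e' * (1 + t) = e" using \<open>t > 0\<close> by (simp add: e'_def)
      moreover have "e' > 0" using \<open>e > 0\<close> \<open>t > 0\<close> by (simp add: e'_def)
      ultimately have e': "e' > 0" "e' + e' * t = e" by (auto simp: algebra_simps)
      obtain g where g: "set_integrable lborel {0..t} g" "\<And>s. s \<in> {0<..t} \<Longrightarrow> \<bar>g s - h s\<bar> \<le> e'"
        "\<bar>(LBINT s:{0..t}. g s) - x t\<bar> \<le> e'"
        using approx[of t e'] \<open>t > 0\<close> e'(1) by blast
      have gh: "set_integrable lborel {0..t} (\<lambda>s. g s - h s)"
        using g(1) int[OF \<open>t > 0\<close>] by (rule set_integral_diff)
      have "\<bar>(LBINT s:{0..t}. g s) - (LBINT s:{0..t}. h s)\<bar> = \<bar>LBINT s:{0..t}. g s - h s\<bar>"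
        using set_integral_diff(2)[OF g(1) int[OF \<open>t > 0\<close>]] by simp
      also have "\<dots> \<le> (LBINT s:{0..t}. \<bar>g s - h s\<bar>)"
        using set_integral_norm_bound[OF gh] by simp
      also have "\<dots> \<le> (LBINT s:{0..t}. e')"
      proof (rule set_integral_mono_AE)
        show "AE s\<in>{0..t} in lborel. \<bar>g s - h s\<bar> \<le> e'"
          using AE0
        proof eventually_elim
          fix s :: real assume "s \<noteq> 0"
          then show "s \<in> {0..t} \<longrightarrow> \<bar>g s - h s\<bar> \<le> e'"
            using g(2)[of s] by auto
        qed
      qed (use gh const in \<open>auto intro: set_integrable_abs\<close>)
      also have "\<dots> = e' * t"
        using \<open>t > 0\<close> by (simp add: set_lebesgue_integral_def)
      finally show ?thesis using g(3) e'(2) by simp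
    qed
    then have "\<bar>x t - (LBINT s:{0..t}. h s)\<bar> \<le> 0" by (rule field_le_epsilon)
    then show ?thesis by simp
  qed
  \<comment> \<open>at time \<open>0\<close> both sides vanish by right continuity\<close>
  have hk: "(LBINT s:{0..t}. h s) = integral {0..t} h" if "t > 0" for t
    using set_borel_integral_eq_integral(2)[OF int[OF that]] .
  have "set_integrable lborel {0..1} h" by (rule int) simp
  from indefinite_integral_continuous_1[OF set_borel_integral_eq_integral(1)[OF this]]
  have "((\<lambda>t. integral {0..t} h) \<longlongrightarrow> integral {0..0} h) (at 0 within {0..1})"
    unfolding continuous_on_def by (rule bspec) simp
  then have "((\<lambda>t. integral {0..t} h) \<longlongrightarrow> 0) (at_right 0)"
    by (simp add: at_within_Icc_at_right)
  moreover have "eventually (\<lambda>t. integral {0..t} h = x t) (at_right 0)"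
    using eventually_at_right_less by eventually_elim (simp add: pos hk)
  ultimately have "(x \<longlongrightarrow> 0) (at_right 0)"
    by (rule Lim_transform_eventually)
  with x have "x 0 = 0" by (rule tendsto_unique[OF trivial_limit_at_right_real])
  moreover have "(LBINT s:{0..0}. h s) = 0"
  proof -
    have "AE s in lborel. indicator {0..0} s *\<^sub>R h s = 0"
      using AE0 by eventually_elim auto
    then show ?thesis unfolding set_lebesgue_integral_def by (rule integral_eq_zero_AE)
  qed
  ultimately show ?thesis using pos[of t] t by (cases "t = 0") auto
qed

section \<open>Measurability and path regularity of simple processes\<close>

text \<open>
  The completeness of the filtration enters through the fifth fact: subsets of null sets are
  measurable, so that events may be determined up to a null set.
\<close>

lemma usual_filtered_prob_spaceD:
  assumes "usual_filtered_prob_space M F"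
  shows "prob_space M" "filtration (space M) F" "\<And>t. sets (F t) \<subseteq> sets M" "\<And>t. space (F t) = space M"
    and "\<And>N N'. N \<in> null_sets M \<Longrightarrow> N' \<subseteq> N \<Longrightarrow> N' \<in> sets M"
    and "\<And>t f. f \<in> borel_measurable (F t) \<Longrightarrow> f \<in> borel_measurable M"
proof -
  note u = assms[unfolded usual_filtered_prob_space_def]
  show "prob_space M" "filtration (space M) F" and sub: "sets (F t) \<subseteq> sets M" for t
    using u by auto
  then show sp: "space (F t) = space M" for t by (simp add: filtration.space_F)
  show "N' \<in> sets M" if "N \<in> null_sets M" "N' \<subseteq> N" for N N'
    using u that by blast
  show "f \<in> borel_measurable M" if "f \<in> borel_measurable (F t)" for t and f :: "_ \<Rightarrow> 'c::topological_space"
    using that measurable_mono[of borel borel "F t" M] sub[of t] sp[of t] by auto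
qed

text \<open>
  A member \<open>A\<close> of the \<open>\<sigma>\<close>-algebra of a real stopping time \<open>T\<close> is the union of the events
  \<open>A \<inter> {T \<le> n}\<close>, which belong to the filtration.
\<close>

lemma simple_predictable_measurable:
  assumes usual: "usual_filtered_prob_space M F" and S: "simple_predictable M F (n, T, K)"
  shows "\<And>k. k \<le> n \<Longrightarrow> T k \<in> borel_measurable M" and "\<And>k. k < n \<Longrightarrow> K k \<in> borel_measurable M"
proof -
  interpret filtration "space M" F using usual by (rule usual_filtered_prob_spaceD)
  note sub = usual_filtered_prob_spaceD(3,4)[OF usual]
  have stop: "stopping_time F (T k)" if "k \<le> n" for k using S that by simp
  show T: "T k \<in> borel_measurable M" if "k \<le> n" for k
    using measurable_stopping_time[OF stop[OF that]] sub by blast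
  show "K k \<in> borel_measurable M" if "k < n" for k
  proof -
    have "sets (pre_sigma (T k)) \<subseteq> sets M"
    proof
      fix A assume A: "A \<in> sets (pre_sigma (T k))"
      have "{\<omega>\<in>A. T k \<omega> \<le> t} \<in> sets M" for t
        using sets_pre_sigmaD[OF stop A, of t] that sub(1)[of t] by auto
      then have "(\<Union>i::nat. {\<omega>\<in>A. T k \<omega> \<le> real i}) \<in> sets M" by blast
      also have "(\<Union>i::nat. {\<omega>\<in>A. T k \<omega> \<le> real i}) = A"
        using real_arch_simple by auto
      finally show "A \<in> sets M" .
    qed
    moreover have "K k \<in> borel_measurable (pre_sigma (T k))" using S that by simp
    ultimately show ?thesis
      using measurable_mono[of borel borel "pre_sigma (T k)" M] by (auto simp: space_pre_sigma)
  qed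
qed

lemma simple_value_measurable:
  assumes "usual_filtered_prob_space M F" "simple_predictable M F S"
  shows "simple_value S t \<in> borel_measurable M"
proof -
  obtain n T K where S: "S = (n, T, K)" by (cases S)
  note m = simple_predictable_measurable[OF assms(1) assms(2)[unfolded S]]
  have "(\<lambda>\<omega>. \<Sum>k<n. K k \<omega> * indicator {T k \<omega><..T (Suc k) \<omega>} t) \<in> borel_measurable M"
  proof (rule borel_measurable_sum)
    fix k assume "k \<in> {..<n}"
    then have [measurable]: "K k \<in> borel_measurable M" "T k \<in> borel_measurable M" "T (Suc k) \<in> borel_measurable M"
      using m by auto
    show "(\<lambda>\<omega>. K k \<omega> * indicator {T k \<omega><..T (Suc k) \<omega>} t) \<in> borel_measurable M"
      by (simp add: indicator_def)
  qed
  then show ?thesis unfolding S simple_value.simps[abs_def] .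
qed

lemma simple_value_left_continuous: "((\<lambda>s. simple_value S s \<omega>) \<longlongrightarrow> simple_value S t \<omega>) (at_left t)"
proof -
  obtain n T K where S: "S = (n, T, K)" by (cases S)
  have "eventually (\<lambda>s. indicator {a<..b} s = (indicator {a<..b} t :: real)) (at_left t)" for a b :: real
  proof -
    consider "t \<le> a" | "a < t" "t \<le> b" | "b < t" by linarith
    then show ?thesis
    proof cases
      case 1
      then show ?thesis by (auto simp: eventually_at_filter)
    next
      case 2
      then show ?thesis
        using eventually_at_left_real[of a t] by (auto elim!: eventually_mono)
    next
      case 3
      then show ?thesis
        using eventually_at_left_real[of b t] by (auto elim!: eventually_mono)
    qed
  qed
  then have "((\<lambda>s. indicator {a<..b} s) \<longlongrightarrow> (indicator {a<..b} t :: real)) (at_left t)" for a b :: real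
    by (rule tendsto_eventually)
  then show ?thesis unfolding S simple_value.simps by (intro tendsto_intros) auto
qed

text \<open>
  Right continuity survives stopping at every \<open>a\<close>: just after \<open>t\<close> the stopped path either is
  constant or runs along \<open>z\<close>.
\<close>

lemma right_continuous_stopped:
  fixes z :: "real \<Rightarrow> real"
  assumes "(z \<longlongrightarrow> z t) (at_right t)"
  shows "((\<lambda>s. z (min a s)) \<longlongrightarrow> z (min a t)) (at_right t)"
proof (cases "a \<le> t")
  case True
  then have "eventually (\<lambda>s. z (min a s) = z (min a t)) (at_right t)"
    by (auto simp: eventually_at_filter)
  then show ?thesis by (rule tendsto_eventually)
next
  case False
  then have "eventually (\<lambda>s. z s = z (min a s)) (at_right t)"
    using eventually_at_right_real[of t a] by (auto elim!: eventually_mono simp: min_def)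
  then show ?thesis using False assms by (auto intro: Lim_transform_eventually)
qed

lemma simple_integral_right_continuous:
  assumes "((\<lambda>s. Z s \<omega>) \<longlongrightarrow> Z t \<omega>) (at_right t)"
  shows "((\<lambda>s. simple_integral S Z s \<omega>) \<longlongrightarrow> simple_integral S Z t \<omega>) (at_right t)"
  by (cases S) (auto intro!: tendsto_intros right_continuous_stopped[where z="\<lambda>s. Z s \<omega>"] assms)

section \<open>Convergence uniformly on compacts in probability\<close>

text \<open>
  Since \<^const>\<open>measure\<close> is \<open>0\<close> on sets that are not measurable, convergence in the sense of
  \<^const>\<open>ucp_lim\<close> says something only once these events are known to be measurable. One-sided
  continuity in either direction lets an exceedance at a time before \<open>t\<close> be witnessed at a
  rational time; the time \<open>t\<close> itself is added because the rational times to its right are out of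
  range.
\<close>

lemma exceedance_event:
  fixes D :: "real \<Rightarrow> 'w \<Rightarrow> real"
  assumes complete: "\<And>N N'. N \<in> null_sets M \<Longrightarrow> N' \<subseteq> N \<Longrightarrow> N' \<in> sets M"
    and meas: "\<And>s. s > 0 \<Longrightarrow> D s \<in> borel_measurable M"
    and paths: "AE \<omega> in M. \<forall>s>0. ((\<lambda>s. D s \<omega>) \<longlongrightarrow> D s \<omega>) (at_left s) \<or> ((\<lambda>s. D s \<omega>) \<longlongrightarrow> D s \<omega>) (at_right s)"
  shows "{\<omega>\<in>space M. \<exists>s\<in>{0<..t}. e < \<bar>D s \<omega>\<bar>} \<in> sets M"
proof -
  let ?Q = "{0<..t} \<inter> (\<rat> \<union> {t})"
  define E where "E = {\<omega>\<in>space M. \<exists>s\<in>{0<..t}. e < \<bar>D s \<omega>\<bar>}"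
  define E' where "E' = (\<Union>s\<in>?Q. {\<omega>\<in>space M. e < \<bar>D s \<omega>\<bar>})"
  obtain N where N: "N \<in> null_sets M" and
    regular: "\<And>\<omega> s. \<omega> \<in> space M \<Longrightarrow> \<omega> \<notin> N \<Longrightarrow> s > 0 \<Longrightarrow>
      ((\<lambda>s. D s \<omega>) \<longlongrightarrow> D s \<omega>) (at_left s) \<or> ((\<lambda>s. D s \<omega>) \<longlongrightarrow> D s \<omega>) (at_right s)"
    using paths by (auto elim!: AE_E3)
  have E': "E' \<in> sets M"
    unfolding E'_def
  proof (rule sets.countable_UN'')
    show "countable ?Q" using countable_rat by (intro countable_Int2) auto
    show "{\<omega>\<in>space M. e < \<bar>D s \<omega>\<bar>} \<in> sets M" if "s \<in> ?Q" for s
    proof -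
      have [measurable]: "D s \<in> borel_measurable M" using meas that by auto
      show ?thesis by measurable
    qed
  qed
  have "E - E' \<subseteq> N"
  proof
    fix \<omega> assume \<omega>: "\<omega> \<in> E - E'"
    then obtain s where s: "0 < s" "s \<le> t" "e < \<bar>D s \<omega>\<bar>" and sp: "\<omega> \<in> space M"
      by (auto simp: E_def)
    have no: "\<not> e < \<bar>D q \<omega>\<bar>" if "q \<in> ?Q" for q
      using \<omega> that sp by (auto simp: E'_def)
    with s have "s < t" by fastforce
    have "\<not> ((\<lambda>s. D s \<omega>) \<longlongrightarrow> D s \<omega>) (at_left s)"
    proof
      assume "((\<lambda>s. D s \<omega>) \<longlongrightarrow> D s \<omega>) (at_left s)"
      from order_tendstoD(1)[OF tendsto_rabs[OF this] s(3)]
      obtain b where b: "b < s" "\<And>q. b < q \<Longrightarrow> q < s \<Longrightarrow> e < \<bar>D q \<omega>\<bar>"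
        using s(1) by (auto simp: eventually_at_left)
      obtain q where "q \<in> \<rat>" "max b 0 < q" "q < s"
        using Rats_dense_in_real[of "max b 0" s] b(1) s(1) by auto
      then show False using no[of q] b(2)[of q] s(2) by auto
    qed
    moreover have "\<not> ((\<lambda>s. D s \<omega>) \<longlongrightarrow> D s \<omega>) (at_right s)"
    proof
      assume "((\<lambda>s. D s \<omega>) \<longlongrightarrow> D s \<omega>) (at_right s)"
      from order_tendstoD(1)[OF tendsto_rabs[OF this] s(3)]
      obtain b where b: "s < b" "\<And>q. s < q \<Longrightarrow> q < b \<Longrightarrow> e < \<bar>D q \<omega>\<bar>"
        using \<open>s < t\<close> by (auto simp: eventually_at_right)
      obtain q where "q \<in> \<rat>" "s < q" "q < min b t"
        using Rats_dense_in_real[of s "min b t"] b(1) \<open>s < t\<close> by auto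
      then show False using no[of q] b(2)[of q] s(1) by auto
    qed
    ultimately show "\<omega> \<in> N" using regular[OF sp] s(1) by blast
  qed
  then have "E - E' \<in> sets M" using complete N by blast
  moreover have "E' \<subseteq> E" by (auto simp: E_def E'_def)
  ultimately have "E = E' \<union> (E - E')" "E - E' \<in> sets M" by auto
  then show ?thesis unfolding E_def[symmetric] using E' by (metis sets.Un)
qed

text \<open>
  Convergence in probability to \<open>0\<close> makes it a null event that one of two approximations fails
  for every large \<open>n\<close>. So almost surely both succeed for the same arbitrarily large \<open>n\<close>; this
  replaces the passage to an almost surely convergent subsequence.
\<close>

lemma ucp_lim_AE_joint:
  assumes "prob_space M" and ucp: "ucp_lim M X Y" "ucp_lim M X' Y'"
    and meas: "\<And>n t e. {\<omega>\<in>space M. \<exists>s\<in>{0<..t}. e < \<bar>X n s \<omega> - Y s \<omega>\<bar>} \<in> sets M"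
      "\<And>n t e. {\<omega>\<in>space M. \<exists>s\<in>{0<..t}. e < \<bar>X' n s \<omega> - Y' s \<omega>\<bar>} \<in> sets M"
  shows "AE \<omega> in M. \<forall>t>0. \<forall>e>0. \<forall>N. \<exists>n\<ge>N. \<forall>s\<in>{0<..t}.
    \<bar>X n s \<omega> - Y s \<omega>\<bar> \<le> e \<and> \<bar>X' n s \<omega> - Y' s \<omega>\<bar> \<le> e"
proof -
  interpret prob_space M by fact
  have "AE \<omega> in M. \<exists>n\<ge>k. \<forall>s\<in>{0<..real (Suc k)}.
      \<bar>X n s \<omega> - Y s \<omega>\<bar> \<le> inverse (Suc k) \<and> \<bar>X' n s \<omega> - Y' s \<omega>\<bar> \<le> inverse (Suc k)" for k :: nat
  proof -
    define C where "C n = {\<omega>\<in>space M. \<exists>s\<in>{0<..real (Suc k)}. inverse (Suc k) < \<bar>X n s \<omega> - Y s \<omega>\<bar>}" for n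
    define C' where "C' n = {\<omega>\<in>space M. \<exists>s\<in>{0<..real (Suc k)}. inverse (Suc k) < \<bar>X' n s \<omega> - Y' s \<omega>\<bar>}" for n
    have [measurable]: "C n \<in> sets M" "C' n \<in> sets M" for n
      using meas by (auto simp: C_def C'_def)
    define Bad where "Bad = (\<Inter>n\<in>{k..}. C n \<union> C' n)"
    have Bad: "Bad \<in> sets M" unfolding Bad_def by (intro sets.countable_INT') auto
    have "(\<lambda>n. measure M (C n)) \<longlonglongrightarrow> 0" "(\<lambda>n. measure M (C' n)) \<longlonglongrightarrow> 0"
      using ucp unfolding ucp_lim_def C_def C'_def by auto
    then have "(\<lambda>n. measure M (C n) + measure M (C' n)) \<longlonglongrightarrow> 0"
      using tendsto_add by fastforce
    moreover have "measure M Bad \<le> measure M (C n) + measure M (C' n)" if "n \<ge> k" for n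
    proof -
      have "measure M Bad \<le> measure M (C n \<union> C' n)"
        using that by (intro finite_measure_mono) (auto simp: Bad_def)
      also have "\<dots> \<le> measure M (C n) + measure M (C' n)"
        by (rule measure_Un_le) auto
      finally show ?thesis .
    qed
    ultimately have "measure M Bad \<le> 0"
      using LIMSEQ_le_const[of "\<lambda>n. measure M (C n) + measure M (C' n)" 0 "measure M Bad"] by blast
    then have "Bad \<in> null_sets M"
      using Bad by (simp add: null_sets_def emeasure_eq_measure measure_le_0_iff)
    then show ?thesis
      by (rule AE_I') (auto simp: Bad_def C_def C'_def not_le, metis not_le)
  qed
  then have "AE \<omega> in M. \<forall>k::nat. \<exists>n\<ge>k. \<forall>s\<in>{0<..real (Suc k)}.
      \<bar>X n s \<omega> - Y s \<omega>\<bar> \<le> inverse (Suc k) \<and> \<bar>X' n s \<omega> - Y' s \<omega>\<bar> \<le> inverse (Suc k)"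
    by (simp add: AE_all_countable)
  then show ?thesis
  proof (eventually_elim, intro allI impI)
    fix \<omega> and t e :: real and N :: nat
    assume *: "\<forall>k::nat. \<exists>n\<ge>k. \<forall>s\<in>{0<..real (Suc k)}.
      \<bar>X n s \<omega> - Y s \<omega>\<bar> \<le> inverse (Suc k) \<and> \<bar>X' n s \<omega> - Y' s \<omega>\<bar> \<le> inverse (Suc k)"
      and "t > 0" "e > 0"
    obtain k1 :: nat where k1: "t \<le> k1" using real_arch_simple by blast
    obtain k2 where k2: "inverse (real (Suc k2)) < e" using reals_Archimedean[OF \<open>e > 0\<close>] by auto
    define k where "k = max N (max k1 k2)"
    have k: "N \<le> k" "t \<le> real (Suc k)" "inverse (real (Suc k)) \<le> e"
    proof -
      show "N \<le> k" "t \<le> real (Suc k)" using k1 by (auto simp: k_def)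
      have "inverse (real (Suc k)) \<le> inverse (real (Suc k2))"
        by (rule le_imp_inverse_le) (auto simp: k_def)
      with k2 show "inverse (real (Suc k)) \<le> e" by linarith
    qed
    from * obtain n where n: "n \<ge> k" "\<And>s. s \<in> {0<..real (Suc k)} \<Longrightarrow>
      \<bar>X n s \<omega> - Y s \<omega>\<bar> \<le> inverse (Suc k) \<and> \<bar>X' n s \<omega> - Y' s \<omega>\<bar> \<le> inverse (Suc k)" by blast
    show "\<exists>n\<ge>N. \<forall>s\<in>{0<..t}. \<bar>X n s \<omega> - Y s \<omega>\<bar> \<le> e \<and> \<bar>X' n s \<omega> - Y' s \<omega>\<bar> \<le> e"
    proof (intro exI[of _ n] conjI ballI)
      show "N \<le> n" using n(1) k(1) by simp
      fix s assume "s \<in> {0<..t}"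
      then have "s \<in> {0<..real (Suc k)}" using k(2) by auto
      from n(2)[OF this] k(3) show "\<bar>X n s \<omega> - Y s \<omega>\<bar> \<le> e" "\<bar>X' n s \<omega> - Y' s \<omega>\<bar> \<le> e" by linarith+
    qed
  qed
qed

text \<open>
  How a stochastic integral is identified path by path: along one path and one sequence of simple
  integrands, the integrands approach \<open>H\<close> and at the same time the elementary integrals
  approach \<open>I\<close>. The difference of integrands is left continuous and the difference of integrals
  right continuous, as the measurability of exceedance events requires.
\<close>

lemma stoch_integral_AE_approx:
  assumes usual: "usual_filtered_prob_space M F"
    and I: "stoch_integral M F H Z I" and S: "simple_approx M F S H"
    and meas: "\<And>n s. s > 0 \<Longrightarrow> simple_integral (S n) Z s \<in> borel_measurable M"
    and Z: "AE \<omega> in M. \<forall>s>0. ((\<lambda>s. Z s \<omega>) \<longlongrightarrow> Z s \<omega>) (at_right s)"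
  shows "AE \<omega> in M. \<forall>t>0. \<forall>e>0. \<forall>N. \<exists>n\<ge>N. \<forall>s\<in>{0<..t}.
    \<bar>simple_value (S n) s \<omega> - H s \<omega>\<bar> \<le> e \<and> \<bar>simple_integral (S n) Z s \<omega> - I s \<omega>\<bar> \<le> e"
proof (rule ucp_lim_AE_joint)
  note u = usual_filtered_prob_spaceD[OF usual]
  show "prob_space M" by (rule u)
  show "ucp_lim M (\<lambda>n. simple_value (S n)) H" using S by (simp add: simple_approx_def)
  show "ucp_lim M (\<lambda>n. simple_integral (S n) Z) I" using I S by (simp add: stoch_integral_def)
  have H: "\<And>s. s > 0 \<Longrightarrow> H s \<in> borel_measurable (F s)" "AE \<omega> in M. caglad (\<lambda>s. H s \<omega>)"
    and I': "\<And>s. s \<ge> 0 \<Longrightarrow> I s \<in> borel_measurable (F s)" "AE \<omega> in M. cadlag (\<lambda>s. I s \<omega>)"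
    using I by (auto simp: stoch_integral_def adapted_caglad_def adapted_cadlag_def)
  fix n t e
  show "{\<omega>\<in>space M. \<exists>s\<in>{0<..t}. e < \<bar>simple_value (S n) s \<omega> - H s \<omega>\<bar>} \<in> sets M"
  proof (rule exceedance_event[OF u(5)])
    show "(\<lambda>\<omega>. simple_value (S n) s \<omega> - H s \<omega>) \<in> borel_measurable M" if "s > 0" for s
      using simple_value_measurable[OF usual] S u(6)[OF H(1)[OF that]]
      by (auto simp: simple_approx_def)
    show "AE \<omega> in M. \<forall>s>0.
        ((\<lambda>s. simple_value (S n) s \<omega> - H s \<omega>) \<longlongrightarrow> simple_value (S n) s \<omega> - H s \<omega>) (at_left s) \<or>
        ((\<lambda>s. simple_value (S n) s \<omega> - H s \<omega>) \<longlongrightarrow> simple_value (S n) s \<omega> - H s \<omega>) (at_right s)"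
      using H(2) by eventually_elim (auto simp: caglad_def intro!: tendsto_diff simple_value_left_continuous)
  qed
  show "{\<omega>\<in>space M. \<exists>s\<in>{0<..t}. e < \<bar>simple_integral (S n) Z s \<omega> - I s \<omega>\<bar>} \<in> sets M"
  proof (rule exceedance_event[OF u(5)])
    show "(\<lambda>\<omega>. simple_integral (S n) Z s \<omega> - I s \<omega>) \<in> borel_measurable M" if "s > 0" for s
      using meas[OF that] u(6)[OF I'(1)] that by auto
    show "AE \<omega> in M. \<forall>s>0.
        ((\<lambda>s. simple_integral (S n) Z s \<omega> - I s \<omega>) \<longlongrightarrow> simple_integral (S n) Z s \<omega> - I s \<omega>) (at_left s) \<or>
        ((\<lambda>s. simple_integral (S n) Z s \<omega> - I s \<omega>) \<longlongrightarrow> simple_integral (S n) Z s \<omega> - I s \<omega>) (at_right s)"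
      using I'(2) Z
      by eventually_elim (auto simp: cadlag_def intro!: tendsto_diff simple_integral_right_continuous)
  qed
qed

section \<open>Integrals with respect to time and of constants\<close>

text \<open>
  Any approximating sequence serves, and the definition of \<^const>\<open>stoch_integral\<close> provides one.
\<close>

lemma stoch_integral_wrt_time:
  assumes usual: "usual_filtered_prob_space M F" and I: "stoch_integral M F H (\<lambda>t \<omega>. t) I"
  shows "AE \<omega> in M. \<forall>t\<ge>0. I t \<omega> = (LBINT s:{0..t}. H s \<omega>)"
proof -
  obtain S where S: "simple_approx M F S H" using I by (auto simp: stoch_integral_def)
  then have pred: "simple_predictable M F (S n)" for n by (simp add: simple_approx_def)
  have meas: "simple_integral (S n) (\<lambda>t \<omega>. t) s \<in> borel_measurable M" for n s
  proof -
    obtain k T K where Sn: "S n = (k, T, K)" by (cases "S n")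
    note m = simple_predictable_measurable[OF usual pred[of n, unfolded Sn]]
    have "(\<lambda>\<omega>. \<Sum>i<k. K i \<omega> * (min (T (Suc i) \<omega>) s - min (T i \<omega>) s)) \<in> borel_measurable M"
      using m by (intro borel_measurable_sum borel_measurable_times borel_measurable_diff borel_measurable_min) auto
    then show ?thesis unfolding Sn simple_integral.simps[abs_def] .
  qed
  have "AE \<omega> in M. \<forall>t>0. \<forall>e>0. \<forall>N. \<exists>n\<ge>N. \<forall>s\<in>{0<..t}.
      \<bar>simple_value (S n) s \<omega> - H s \<omega>\<bar> \<le> e \<and> \<bar>simple_integral (S n) (\<lambda>t \<omega>. t) s \<omega> - I s \<omega>\<bar> \<le> e"
    by (rule stoch_integral_AE_approx[OF usual I S meas]) auto
  moreover have "AE \<omega> in M. caglad (\<lambda>s. H s \<omega>)" "AE \<omega> in M. cadlag (\<lambda>s. I s \<omega>)"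
    using I by (auto simp: stoch_integral_def adapted_caglad_def adapted_cadlag_def)
  ultimately show ?thesis
    using AE_space
  proof (eventually_elim, intro allI impI)
    fix \<omega> and t :: real
    assume approx: "\<forall>t>0. \<forall>e>0. \<forall>N. \<exists>n\<ge>N. \<forall>s\<in>{0<..t}.
      \<bar>simple_value (S n) s \<omega> - H s \<omega>\<bar> \<le> e \<and> \<bar>simple_integral (S n) (\<lambda>t \<omega>. t) s \<omega> - I s \<omega>\<bar> \<le> e"
      and H: "caglad (\<lambda>s. H s \<omega>)" and I: "cadlag (\<lambda>s. I s \<omega>)" and \<omega>: "\<omega> \<in> space M" and t: "t \<ge> 0"
    show "I t \<omega> = (LBINT s:{0..t}. H s \<omega>)"
    proof (rule integral_eq_if_approximable[OF H _ _ t])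
      show "((\<lambda>s. I s \<omega>) \<longlongrightarrow> I 0 \<omega>) (at_right 0)" using I by (simp add: cadlag_def)
      fix t e :: real assume te: "t > 0" "e > 0"
      with approx obtain n where n: "\<And>s. s \<in> {0<..t} \<Longrightarrow> \<bar>simple_value (S n) s \<omega> - H s \<omega>\<bar> \<le> e"
        "\<And>s. s \<in> {0<..t} \<Longrightarrow> \<bar>simple_integral (S n) (\<lambda>t \<omega>. t) s \<omega> - I s \<omega>\<bar> \<le> e" by blast
      obtain k T K where Sn: "S n = (k, T, K)" by (cases "S n")
      have T: "T 0 \<omega> = 0" "\<And>i. i < k \<Longrightarrow> T i \<omega> \<le> T (Suc i) \<omega>"
        using pred[of n] \<omega> by (auto simp: Sn)
      have "set_integrable lborel {0..t} (\<lambda>s. simple_value (S n) s \<omega>)"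
        "(LBINT s:{0..t}. simple_value (S n) s \<omega>) = simple_integral (S n) (\<lambda>t \<omega>. t) t \<omega>"
        unfolding Sn using simple_integral_wrt_time[where T=T, OF T] te(1) by auto
      with n te(1) show "\<exists>g. set_integrable lborel {0..t} g \<and> (\<forall>s\<in>{0<..t}. \<bar>g s - H s \<omega>\<bar> \<le> e) \<and>
          \<bar>(LBINT s:{0..t}. g s) - I t \<omega>\<bar> \<le> e"
        by (intro exI[of _ "\<lambda>s. simple_value (S n) s \<omega>"]) auto
    qed
  qed
qed

text \<open>
  A constant is approximated by the simple processes \<open>c 1\<^bsub>(0,n]\<^esub>\<close>, which equal it on \<open>(0, t]\<close>
  as soon as \<open>n \<ge> t\<close>, and whose elementary integrals are then \<open>c (Z\<^sub>t - Z\<^sub>0)\<close>.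
\<close>

lemma stoch_integral_const:
  assumes usual: "usual_filtered_prob_space M F" and I: "stoch_integral M F (\<lambda>_ _. c) Z I"
    and Z: "\<And>t. t \<ge> 0 \<Longrightarrow> Z t \<in> borel_measurable (F t)"
      "AE \<omega> in M. \<forall>t\<ge>0. ((\<lambda>s. Z s \<omega>) \<longlongrightarrow> Z t \<omega>) (at_right t)"
  shows "AE \<omega> in M. \<forall>t\<ge>0. I t \<omega> = c * (Z t \<omega> - Z 0 \<omega>)"
proof -
  define S :: "nat \<Rightarrow> 'a simple_process" where "S n = (1, (\<lambda>k _. real k * real n), (\<lambda>_ _. c))" for n
  have value_eq: "simple_value (S n) s \<omega> = c" if "0 < s" "s \<le> real n" for n s \<omega>
    using that by (simp add: S_def)
  have integral_eq: "simple_integral (S n) Z s \<omega> = c * (Z s \<omega> - Z 0 \<omega>)" if "0 < s" "s \<le> real n" for n s \<omega>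
    using that by (simp add: S_def min_def)
  have S: "simple_approx M F S (\<lambda>_ _. c)"
    unfolding simple_approx_def ucp_lim_def
  proof (intro conjI allI impI)
    show "simple_predictable M F (S n)" for n
      by (auto simp: S_def stopping_time_const)
    fix t e :: real assume te: "t > 0" "e > 0"
    obtain N :: nat where N: "t \<le> real N" using real_arch_simple by blast
    have "{\<omega>\<in>space M. \<exists>s\<in>{0<..t}. e < \<bar>simple_value (S n) s \<omega> - c\<bar>} = {}" if "n \<ge> N" for n
    proof -
      have "simple_value (S n) s \<omega> = c" if "s \<in> {0<..t}" for s \<omega>
        using that N \<open>n \<ge> N\<close> by (intro value_eq) auto
      with te show ?thesis by auto
    qed
    then have "measure M {\<omega>\<in>space M. \<exists>s\<in>{0<..t}. e < \<bar>simple_value (S n) s \<omega> - c\<bar>} = 0" if "n \<ge> N" for n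
      using that by (simp only: measure_empty)
    then have "eventually (\<lambda>n. measure M {\<omega>\<in>space M. \<exists>s\<in>{0<..t}. e < \<bar>simple_value (S n) s \<omega> - c\<bar>} = 0) sequentially"
      unfolding eventually_sequentially by blast
    then show "(\<lambda>n. measure M {\<omega>\<in>space M. \<exists>s\<in>{0<..t}. e < \<bar>simple_value (S n) s \<omega> - c\<bar>}) \<longlonglongrightarrow> 0"
      by (rule tendsto_eventually)
  qed
  have Zm: "Z t \<in> borel_measurable M" if "t \<ge> 0" for t
    using usual_filtered_prob_spaceD(6)[OF usual Z(1)[OF that]] .
  have meas: "simple_integral (S n) Z s \<in> borel_measurable M" if "s > 0" for n s
  proof -
    have "simple_integral (S n) Z s = (\<lambda>\<omega>. c * (Z (min (real n) s) \<omega> - Z 0 \<omega>))"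
      using that by (auto simp: S_def min_def)
    then show ?thesis using that Zm by simp
  qed
  have "AE \<omega> in M. \<forall>t>0. \<forall>e>0. \<forall>N. \<exists>n\<ge>N. \<forall>s\<in>{0<..t}.
      \<bar>simple_value (S n) s \<omega> - c\<bar> \<le> e \<and> \<bar>simple_integral (S n) Z s \<omega> - I s \<omega>\<bar> \<le> e"
    by (rule stoch_integral_AE_approx[OF usual I S meas]) (use Z(2) in auto)
  moreover have "AE \<omega> in M. cadlag (\<lambda>s. I s \<omega>)"
    using I by (auto simp: stoch_integral_def adapted_cadlag_def)
  ultimately show ?thesis
    using Z(2)
  proof (eventually_elim, intro allI impI)
    fix \<omega> and t :: real
    assume approx: "\<forall>t>0. \<forall>e>0. \<forall>N. \<exists>n\<ge>N. \<forall>s\<in>{0<..t}.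
      \<bar>simple_value (S n) s \<omega> - c\<bar> \<le> e \<and> \<bar>simple_integral (S n) Z s \<omega> - I s \<omega>\<bar> \<le> e"
      and I: "cadlag (\<lambda>s. I s \<omega>)" and Z: "\<forall>t\<ge>0. ((\<lambda>s. Z s \<omega>) \<longlongrightarrow> Z t \<omega>) (at_right t)" and t: "t \<ge> 0"
    have pos: "I t \<omega> = c * (Z t \<omega> - Z 0 \<omega>)" if "t > 0" for t
    proof -
      have "\<bar>c * (Z t \<omega> - Z 0 \<omega>) - I t \<omega>\<bar> \<le> 0 + e" if "e > 0" for e
      proof -
        obtain N :: nat where N: "t \<le> real N" using real_arch_simple by blast
        from approx[rule_format, OF \<open>t > 0\<close> \<open>e > 0\<close>, of N] obtain n where n: "n \<ge> N"
          "\<And>s. s \<in> {0<..t} \<Longrightarrow> \<bar>simple_integral (S n) Z s \<omega> - I s \<omega>\<bar> \<le> e" by auto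
        have "simple_integral (S n) Z t \<omega> = c * (Z t \<omega> - Z 0 \<omega>)"
          using N n(1) \<open>t > 0\<close> by (intro integral_eq) auto
        with n(2)[of t] \<open>t > 0\<close> show ?thesis by simp
      qed
      then have "\<bar>c * (Z t \<omega> - Z 0 \<omega>) - I t \<omega>\<bar> \<le> 0" by (rule field_le_epsilon)
      then show ?thesis by simp
    qed
    \<comment> \<open>time \<open>0\<close> is reached by right continuity, as ucp convergence says nothing about it\<close>
    have "((\<lambda>t. c * (Z t \<omega> - Z 0 \<omega>)) \<longlongrightarrow> c * (Z 0 \<omega> - Z 0 \<omega>)) (at_right 0)"
      using Z by (intro tendsto_intros) auto
    moreover have "eventually (\<lambda>t. c * (Z t \<omega> - Z 0 \<omega>) = I t \<omega>) (at_right 0)"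
      using eventually_at_right_less by eventually_elim (simp add: pos)
    ultimately have "((\<lambda>t. I t \<omega>) \<longlongrightarrow> 0) (at_right 0)"
      using Lim_transform_eventually by fastforce
    moreover have "((\<lambda>t. I t \<omega>) \<longlongrightarrow> I 0 \<omega>) (at_right 0)" using I by (simp add: cadlag_def)
    ultimately have "I 0 \<omega> = 0" by (metis tendsto_unique trivial_limit_at_right_real)
    with pos[of t] t show "I t \<omega> = c * (Z t \<omega> - Z 0 \<omega>)" by (cases "t = 0") auto
  qed
qed



section \<open>The coefficients of the intervened equation\<close>

lemma vec_delete_vec_insert: "m \<le> dim_vec v \<Longrightarrow> vec_delete m (vec_insert m c v) = v"
  by (intro eq_vecI) (auto simp: vec_delete_def vec_insert_def insert_index_def delete_index_def)

lemma insert_index_less: "m < p \<Longrightarrow> i < p - 1 \<Longrightarrow> insert_index m i < p"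
  by (auto simp: insert_index_def)

text \<open>
  The intervened coordinate contributes the single summand \<open>b\<^bsub>im\<^esub> (c - a\<^sub>m)\<close> to row \<open>i\<close> of
  \<open>B (x - A)\<close>; the other summands form the product with the reduced matrix.
\<close>

lemma mult_vec_insert_index:
  fixes B :: "real mat" and A y :: "real vec"
  assumes A: "A \<in> carrier_vec p" and B: "B \<in> carrier_mat p p" and m: "m < p"
    and y: "y \<in> carrier_vec (p - 1)" and i: "i < p - 1"
  shows "(B *\<^sub>v (vec_insert m c y - A)) $ insert_index m i =
    (mat_delete B m m *\<^sub>v (y - vec_delete m A)) $ i + B $$ (insert_index m i, m) * (c - A $ m)"
proof -
  let ?i = "insert_index m i"
  let ?f = "\<lambda>k. B $$ (?i, k) * ((vec_insert m c y) $ k - A $ k)"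
  have dims: "dim_vec y = p - 1" "dim_vec A = p" "dim_row B = p" "dim_col B = p" "Suc (p - 1) = p"
    using A B y m by auto
  have "(B *\<^sub>v (vec_insert m c y - A)) $ ?i = (\<Sum>k\<in>{0..<p}. ?f k)"
    using insert_index_less[OF m i] dims by (simp add: scalar_prod_def vec_insert_def)
  also have "\<dots> = ?f m + (\<Sum>k\<in>{0..<p} - {m}. ?f k)"
    using m by (intro sum.remove) auto
  also have "{0..<p} - {m} = insert_index m ` {0..<p - 1}"
    using insert_index_image[of m "p - 1"] m dims(5) by simp
  also have "(\<Sum>k\<in>insert_index m ` {0..<p - 1}. ?f k) = (\<Sum>k\<in>{0..<p - 1}. ?f (insert_index m k))"
    by (subst sum.reindex) (auto simp: insert_index_inj_on)
  also have "\<dots> = (mat_delete B m m *\<^sub>v (y - vec_delete m A)) $ i"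
  proof -
    have "vec_insert m c y $ insert_index m k = y $ k" if "k < p - 1" for k
      using insert_index_less[OF m that] dims by (simp add: vec_insert_def)
    moreover have "mat_delete B m m $$ (i, k) = B $$ (insert_index m i, insert_index m k)" if "k < p - 1" for k
      using i that dims by (simp add: mat_delete_def insert_index_def)
    moreover have "mat_delete B m m \<in> carrier_mat (p - 1) (p - 1)" using B by (rule mat_delete_carrier)
    ultimately show ?thesis
      using i dims by (simp add: scalar_prod_def vec_delete_def)
  qed
  also have "?f m = B $$ (?i, m) * (c - A $ m)"
    using m dims by (simp add: vec_insert_def)
  finally show ?thesis by simp
qed

lemma invertible_mult_mat_inverse:
  fixes B :: "'a :: field mat"
  assumes B: "B \<in> carrier_mat n n" and inv: "invertible_mat B"
  shows "the (mat_inverse B) \<in> carrier_mat n n" "B * the (mat_inverse B) = 1\<^sub>m n"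
proof -
  obtain C where C: "B * C = 1\<^sub>m n" "C * B = 1\<^sub>m (dim_row C)"
    using inv B by (auto simp: invertible_mat_def inverts_mat_def)
  have "dim_col C = n" using arg_cong[OF C(1), of dim_col] by simp
  moreover have "dim_row C = n" using arg_cong[OF C(2), of dim_col] B by simp
  ultimately have "C \<in> carrier_mat n n" by auto
  with B C have "B \<in> Units (ring_mat TYPE('a) n ())"
    by (auto simp: Units_def ring_mat_def)
  then obtain D where D: "mat_inverse B = Some D"
    using mat_inverse(1)[OF B, where b="()"] by fastforce
  with mat_inverse(2)[OF B D]
  show "the (mat_inverse B) \<in> carrier_mat n n" "B * the (mat_inverse B) = 1\<^sub>m n" by auto
qed

text \<open>
  Moving the mean reversion level by \<open>B\<^sup>-\<^sup>1 \<beta>\<close> absorbs a constant drift \<open>\<beta>\<close>.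
\<close>

lemma affine_drift_recentered:
  fixes B :: "real mat"
  assumes B: "B \<in> carrier_mat n n" and inv: "invertible_mat B"
    and v: "\<alpha> \<in> carrier_vec n" "\<beta> \<in> carrier_vec n" "y \<in> carrier_vec n"
  shows "B *\<^sub>v (y - (\<alpha> - the (mat_inverse B) *\<^sub>v \<beta>)) = B *\<^sub>v (y - \<alpha>) + \<beta>"
proof -
  note C = invertible_mult_mat_inverse[OF B inv]
  define w where "w = the (mat_inverse B) *\<^sub>v \<beta>"
  have w: "w \<in> carrier_vec n" using C(1) v by (auto simp: w_def)
  have "y - (\<alpha> - w) = (y - \<alpha>) + w"
    using v w by (intro eq_vecI) auto
  then have "B *\<^sub>v (y - (\<alpha> - w)) = B *\<^sub>v (y - \<alpha>) + B *\<^sub>v w"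
    using mult_add_distrib_mat_vec[OF B, of "y - \<alpha>" w] v w by simp
  also have "B *\<^sub>v w = \<beta>"
    using assoc_mult_mat_vec[OF B C(1) v(2)] C(2) v(2) by (simp add: w_def)
  finally show ?thesis by (simp add: w_def)
qed

lemma intervened_ou_coeff_index:
  assumes "A \<in> carrier_vec p" "B \<in> carrier_mat p p" "\<sigma> \<in> carrier_mat p d" "m < p" "i < p - 1"
  shows "intervened_coeff (ou_coeff A B \<sigma>) m c y $$ (i, 0) = (B *\<^sub>v (vec_insert m c y - A)) $ insert_index m i"
    and "j < d \<Longrightarrow> intervened_coeff (ou_coeff A B \<sigma>) m c y $$ (i, Suc j) = \<sigma> $$ (insert_index m i, j)"
  using assms insert_index_less[of m p i]
  by (auto simp: intervened_coeff_def mat_delete_row_def ou_coeff_def mat_of_cols_index)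

section \<open>Paths of vector-valued processes\<close>

text \<open>
  The equation is driven through left limits, whereas the Ornstein-Uhlenbeck equation has the
  process itself under a Lebesgue integral, which does not see countably many times.
\<close>

lemma left_limit_eq_except_countable:
  assumes "\<And>i. i < n \<Longrightarrow> cadlag (\<lambda>t. X t \<omega> $ i)" and "\<And>t. t \<ge> 0 \<Longrightarrow> X t \<omega> \<in> carrier_vec n"
  shows "countable {t. 0 < t \<and> left_limit n X t \<omega> \<noteq> X t \<omega>}"
proof (rule countable_subset)
  let ?D = "\<Union>i<n. {t. 0 < t \<and> \<not> isCont (\<lambda>t. X t \<omega> $ i) t}"
  show "countable ?D" using assms(1) by (intro countable_UN cadlag_countable_discontinuities) auto
  show "{t. 0 < t \<and> left_limit n X t \<omega> \<noteq> X t \<omega>} \<subseteq> ?D"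
  proof (clarify, rule ccontr)
    fix t :: real assume t: "0 < t" "left_limit n X t \<omega> \<noteq> X t \<omega>" "t \<notin> ?D"
    have "left_limit n X t \<omega> = X t \<omega>"
    proof (rule eq_vecI)
      fix i assume "i < dim_vec (X t \<omega>)"
      then have i: "i < n" using assms(2)[of t] t(1) by simp
      then have "isCont (\<lambda>s. X s \<omega> $ i) t" using t by auto
      then have "((\<lambda>s. X s \<omega> $ i) \<longlongrightarrow> X t \<omega> $ i) (at_left t)"
        unfolding isCont_def by (rule filterlim_mono[OF _ order_refl at_le]) simp
      then show "left_limit n X t \<omega> $ i = X t \<omega> $ i"
        using i by (simp add: left_limit_def tendsto_Lim)
    qed (use assms(2)[of t] t(1) in \<open>simp add: left_limit_def\<close>)
    with t(2) show False by simp
  qed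
qed

lemma cadlag_cong: "cadlag f \<longleftrightarrow> cadlag g" if eq: "\<And>t. t \<ge> 0 \<Longrightarrow> f t = g t"
proof -
  have "(f \<longlongrightarrow> l) (at_right t) \<longleftrightarrow> (g \<longlongrightarrow> l) (at_right t)" if "t \<ge> 0" for t l
    using that eventually_at_right_less[of t] by (intro tendsto_cong) (auto elim!: eventually_mono simp: eq)
  moreover have "(f \<longlongrightarrow> l) (at_left t) \<longleftrightarrow> (g \<longlongrightarrow> l) (at_left t)" if "t > 0" for t l
    using eventually_at_left_real[OF that] by (intro tendsto_cong) (auto elim!: eventually_mono simp: eq)
  ultimately show ?thesis using eq by (auto simp: cadlag_def)
qed

lemma vec_adapted_cadlag_cong:
  assumes usual: "usual_filtered_prob_space M F"
    and eq: "\<And>t \<omega>. t \<ge> 0 \<Longrightarrow> \<omega> \<in> space M \<Longrightarrow> X t \<omega> = Y t \<omega>"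
    and X: "vec_adapted_cadlag M F n X"
  shows "vec_adapted_cadlag M F n Y"
  unfolding vec_adapted_cadlag_def adapted_cadlag_def
proof (intro conjI allI impI ballI)
  show "Y t \<omega> \<in> carrier_vec n" if "t \<ge> 0" "\<omega> \<in> space M" for t \<omega>
  proof -
    have "X t \<omega> \<in> carrier_vec n" using X that by (simp add: vec_adapted_cadlag_def)
    then show ?thesis by (simp add: eq[OF that])
  qed
  fix i assume i: "i < n"
  show "(\<lambda>\<omega>. Y t \<omega> $ i) \<in> borel_measurable (F t)" if "t \<ge> 0" for t
  proof -
    have "(\<lambda>\<omega>. X t \<omega> $ i) \<in> borel_measurable (F t)"
      using X i that by (auto simp: vec_adapted_cadlag_def adapted_cadlag_def)
    then show ?thesis
      using eq[OF that] usual_filtered_prob_spaceD(4)[OF usual]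
      by (subst measurable_cong[of _ _ "\<lambda>\<omega>. X t \<omega> $ i"]) auto
  qed
  have "AE \<omega> in M. cadlag (\<lambda>t. X t \<omega> $ i)"
    using X i by (auto simp: vec_adapted_cadlag_def adapted_cadlag_def)
  then show "AE \<omega> in M. cadlag (\<lambda>t. Y t \<omega> $ i)"
    using AE_space by eventually_elim (subst cadlag_cong, auto simp: eq[symmetric])
qed

lemma brownian_motion_paths:
  assumes W: "brownian_motion M F d W" and j: "j < d"
  shows "\<And>t. t \<ge> 0 \<Longrightarrow> (\<lambda>\<omega>. W t \<omega> $ j) \<in> borel_measurable (F t)"
    and "AE \<omega> in M. W 0 \<omega> $ j = 0"
    and "AE \<omega> in M. \<forall>t\<ge>0. ((\<lambda>s. W s \<omega> $ j) \<longlongrightarrow> W t \<omega> $ j) (at_right t)"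
proof -
  have B: "AE \<omega> in M. W 0 \<omega> = 0\<^sub>v d" "AE \<omega> in M. \<forall>i<d. continuous_on {0..} (\<lambda>t. W t \<omega> $ i)"
    using W unfolding brownian_motion_def by blast+
  show "(\<lambda>\<omega>. W t \<omega> $ j) \<in> borel_measurable (F t)" if "t \<ge> 0" for t
    using W j that unfolding brownian_motion_def by blast
  show "AE \<omega> in M. W 0 \<omega> $ j = 0" using B(1) by eventually_elim (simp add: j)
  show "AE \<omega> in M. \<forall>t\<ge>0. ((\<lambda>s. W s \<omega> $ j) \<longlongrightarrow> W t \<omega> $ j) (at_right t)"
    using B(2)
  proof (eventually_elim, intro allI impI)
    fix \<omega> and t :: real assume "\<forall>i<d. continuous_on {0..} (\<lambda>t. W t \<omega> $ i)" "t \<ge> 0"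
    then have "((\<lambda>s. W s \<omega> $ j) \<longlongrightarrow> W t \<omega> $ j) (at t within {0..})"
      using j by (auto simp: continuous_on_def)
    then show "((\<lambda>s. W s \<omega> $ j) \<longlongrightarrow> W t \<omega> $ j) (at_right t)"
      by (rule filterlim_mono[OF _ order_refl at_le]) (use \<open>t \<ge> 0\<close> in auto)
  qed
qed

section \<open>The intervened Ornstein-Uhlenbeck equation\<close>

theorem lemma3p1:
  fixes M :: "'w measure" and F :: "real \<Rightarrow> 'w measure"
    and W X Y :: "real \<Rightarrow> 'w \<Rightarrow> real vec"
    and A x0 :: "real vec" and B \<sigma> :: "real mat"
    and p d m :: nat and c :: real
  defines "Bt \<equiv> mat_delete B m m"
    and "\<sigma>t \<equiv> mat_delete_row m \<sigma>"
    and "y0 \<equiv> vec_delete m x0"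
    and "\<alpha> \<equiv> vec_delete m A"
    and "\<beta> \<equiv> vec_delete m (vec p (\<lambda>i. B $$ (i, m) * (c - A $ m)))"
  defines "At \<equiv> \<alpha> - the (mat_inverse Bt) *\<^sub>v \<beta>"
  assumes "usual_filtered_prob_space M F"
    and "brownian_motion M F d W"
    and "A \<in> carrier_vec p" and "B \<in> carrier_mat p p" and "\<sigma> \<in> carrier_mat p d"
    and "x0 \<in> carrier_vec p"
    and "m < p"
    and "ou_solution M F p A B \<sigma> W x0 X"
    and "intervened_process M F p (Suc d) (ou_coeff A B \<sigma>) (ou_driver W) x0 m c Y"
    and "invertible_mat Bt"
  shows "ou_solution M F (p - 1) At Bt \<sigma>t W y0 (\<lambda>t \<omega>. vec_delete m (Y t \<omega>))"
proof -
  note usual = assms(7) and W = assms(8) and A = assms(9) and B = assms(10) and \<sigma> = assms(11)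
    and x0 = assms(12) and m = assms(13) and inv = assms(16)
  let ?n = "p - 1"
  let ?b = "intervened_coeff (ou_coeff A B \<sigma>) m c"
  obtain U where U: "sde_solution M F ?n (Suc d) ?b (ou_driver W) y0 U"
    and YU: "\<And>t \<omega>. t \<ge> 0 \<Longrightarrow> \<omega> \<in> space M \<Longrightarrow> Y t \<omega> = vec_insert m c (U t \<omega>)"
    using assms(15) unfolding intervened_process_def y0_def by auto
  obtain I where U_reg: "vec_adapted_cadlag M F ?n U"
    and I: "\<And>i j. i < ?n \<Longrightarrow> j < Suc d \<Longrightarrow> stoch_integral M F
        (\<lambda>t \<omega>. ?b (left_limit ?n U t \<omega>) $$ (i, j)) (\<lambda>t \<omega>. ou_driver W t \<omega> $ j) (I i j)"
    and U_eq: "AE \<omega> in M. \<forall>t\<ge>0. \<forall>i<?n. U t \<omega> $ i = y0 $ i + (\<Sum>j<Suc d. I i j t \<omega>)"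
    using U unfolding sde_solution_def by blast
  have U_dim: "U t \<omega> \<in> carrier_vec ?n" if "t \<ge> 0" "\<omega> \<in> space M" for t \<omega>
    using U_reg that by (auto simp: vec_adapted_cadlag_def)
  have U_cadlag: "AE \<omega> in M. \<forall>i<?n. cadlag (\<lambda>t. U t \<omega> $ i)"
    using U_reg by (auto simp: vec_adapted_cadlag_def adapted_cadlag_def AE_all_countable AE_impI)
  have Y_delete: "vec_delete m (Y t \<omega>) = U t \<omega>" if "t \<ge> 0" "\<omega> \<in> space M" for t \<omega>
    using YU[OF that] U_dim[OF that] m by (simp add: vec_delete_vec_insert)
  have dims: "Bt \<in> carrier_mat ?n ?n" "\<alpha> \<in> carrier_vec ?n" "\<beta> \<in> carrier_vec ?n"
    "y0 \<in> carrier_vec ?n" "\<sigma>t \<in> carrier_mat ?n d"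
    using A B x0 \<sigma> by (auto simp: Bt_def \<alpha>_def \<beta>_def y0_def \<sigma>t_def vec_delete_def mat_delete_row_def mat_delete_carrier)
  have drift: "?b y $$ (i, 0) = (Bt *\<^sub>v (y - At)) $ i" if "y \<in> carrier_vec ?n" "i < ?n" for y i
  proof -
    have "(Bt *\<^sub>v (y - At)) $ i = (Bt *\<^sub>v (y - \<alpha>)) $ i + \<beta> $ i"
      unfolding At_def affine_drift_recentered[OF dims(1) inv dims(2,3) that(1)]
      using dims(3) that(2) by simp
    also have "\<beta> $ i = B $$ (insert_index m i, m) * (c - A $ m)"
      using that(2) insert_index_less[OF m that(2)] by (simp add: \<beta>_def vec_delete_def)
    finally show ?thesis
      using intervened_ou_coeff_index(1)[OF A B \<sigma> m that(2)] mult_vec_insert_index[OF A B m that]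
      by (simp add: Bt_def \<alpha>_def)
  qed
  have I_drift: "AE \<omega> in M. \<forall>t\<ge>0. I i 0 t \<omega> = (LBINT s:{0..t}. (Bt *\<^sub>v (U s \<omega> - At)) $ i)"
    if i: "i < ?n" for i
  proof -
    have "left_limit ?n U t \<omega> \<in> carrier_vec ?n" for t \<omega> by (simp add: left_limit_def)
    with I[OF i, of 0] have "stoch_integral M F (\<lambda>t \<omega>. (Bt *\<^sub>v (left_limit ?n U t \<omega> - At)) $ i) (\<lambda>t \<omega>. t) (I i 0)"
      using i by (simp add: drift ou_driver_def)
    from stoch_integral_wrt_time[OF usual this] U_cadlag AE_space show ?thesis
    proof (eventually_elim, intro allI impI)
      fix \<omega> and t :: real
      assume eq: "\<forall>t\<ge>0. I i 0 t \<omega> = (LBINT s:{0..t}. (Bt *\<^sub>v (left_limit ?n U s \<omega> - At)) $ i)"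
        and cad: "\<forall>i<?n. cadlag (\<lambda>t. U t \<omega> $ i)" and \<omega>: "\<omega> \<in> space M" and t: "t \<ge> 0"
      show "I i 0 t \<omega> = (LBINT s:{0..t}. (Bt *\<^sub>v (U s \<omega> - At)) $ i)"
        \<comment> \<open>the left limit at time \<open>0\<close> would involve negative times, so \<open>0\<close> joins the exceptional set\<close>
        unfolding eq[rule_format, OF t] set_lebesgue_integral_def
      proof (rule integral_discrete_difference)
        let ?D = "insert 0 {t. 0 < t \<and> left_limit ?n U t \<omega> \<noteq> U t \<omega>}"
        show "countable ?D"
          using left_limit_eq_except_countable[of ?n U \<omega>] cad U_dim[OF _ \<omega>] by auto
        show "indicator {0..t} s *\<^sub>R (Bt *\<^sub>v (left_limit ?n U s \<omega> - At)) $ i =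
            indicator {0..t} s *\<^sub>R (Bt *\<^sub>v (U s \<omega> - At)) $ i" if "s \<notin> ?D" for s
          using that by (auto simp: indicator_def)
      qed auto
    qed
  qed
  have I_noise: "AE \<omega> in M. \<forall>t\<ge>0. I i (Suc j) t \<omega> = \<sigma>t $$ (i, j) * W t \<omega> $ j"
    if i: "i < ?n" and j: "j < d" for i j
  proof -
    have "?b y $$ (i, Suc j) = \<sigma>t $$ (i, j)" for y
      using intervened_ou_coeff_index(2)[OF A B \<sigma> m i j] i j \<sigma>
      by (simp add: \<sigma>t_def mat_delete_row_def)
    with I[OF i, of "Suc j"] j
    have "stoch_integral M F (\<lambda>_ _. \<sigma>t $$ (i, j)) (\<lambda>t \<omega>. W t \<omega> $ j) (I i (Suc j))"
      by (simp add: ou_driver_def vec_index_vCons)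
    then have "AE \<omega> in M. \<forall>t\<ge>0. I i (Suc j) t \<omega> = \<sigma>t $$ (i, j) * (W t \<omega> $ j - W 0 \<omega> $ j)"
      using brownian_motion_paths(1,3)[OF W j] by (rule stoch_integral_const[OF usual])
    then show ?thesis
      using brownian_motion_paths(2)[OF W j] by eventually_elim simp
  qed
  have "AE \<omega> in M. \<forall>i<?n. \<forall>t\<ge>0. I i 0 t \<omega> = (LBINT s:{0..t}. (Bt *\<^sub>v (U s \<omega> - At)) $ i)"
    using I_drift by (simp add: AE_all_countable AE_impI)
  moreover have "AE \<omega> in M. \<forall>i<?n. \<forall>j<d. \<forall>t\<ge>0. I i (Suc j) t \<omega> = \<sigma>t $$ (i, j) * W t \<omega> $ j"
    using I_noise by (simp add: AE_all_countable AE_impI)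
  ultimately have "AE \<omega> in M. \<forall>t\<ge>0. vec_delete m (Y t \<omega>) = y0 +
      vec ?n (\<lambda>i. LBINT s:{0..t}. (Bt *\<^sub>v (vec_delete m (Y s \<omega>) - At)) $ i) + \<sigma>t *\<^sub>v W t \<omega>"
    using U_eq AE_space
  proof (eventually_elim, intro allI impI)
    fix \<omega> and t :: real
    assume drift: "\<forall>i<?n. \<forall>t\<ge>0. I i 0 t \<omega> = (LBINT s:{0..t}. (Bt *\<^sub>v (U s \<omega> - At)) $ i)"
      and noise: "\<forall>i<?n. \<forall>j<d. \<forall>t\<ge>0. I i (Suc j) t \<omega> = \<sigma>t $$ (i, j) * W t \<omega> $ j"
      and eq: "\<forall>t\<ge>0. \<forall>i<?n. U t \<omega> $ i = y0 $ i + (\<Sum>j<Suc d. I i j t \<omega>)"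
      and \<omega>: "\<omega> \<in> space M" and t: "t \<ge> 0"
    have W_dim: "W t \<omega> \<in> carrier_vec d" using W \<omega> t by (simp add: brownian_motion_def)
    have "U t \<omega> = y0 + vec ?n (\<lambda>i. LBINT s:{0..t}. (Bt *\<^sub>v (U s \<omega> - At)) $ i) + \<sigma>t *\<^sub>v W t \<omega>"
    proof (rule eq_vecI)
      fix i assume "i < dim_vec (y0 + vec ?n (\<lambda>i. LBINT s:{0..t}. (Bt *\<^sub>v (U s \<omega> - At)) $ i) + \<sigma>t *\<^sub>v W t \<omega>)"
      then have i: "i < ?n" using dims(5) by simp
      have "U t \<omega> $ i = y0 $ i + (\<Sum>j<Suc d. I i j t \<omega>)" using eq t i by blast
      also have "\<dots> = y0 $ i + I i 0 t \<omega> + (\<Sum>j<d. I i (Suc j) t \<omega>)"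
        by (simp only: sum.lessThan_Suc_shift add.assoc)
      also have "(\<Sum>j<d. I i (Suc j) t \<omega>) = (\<Sum>j<d. \<sigma>t $$ (i, j) * W t \<omega> $ j)"
        using noise i t by (intro sum.cong) auto
      also have "\<dots> = (\<sigma>t *\<^sub>v W t \<omega>) $ i"
        using dims(5) W_dim i by (simp add: scalar_prod_def atLeast0LessThan)
      also have "I i 0 t \<omega> = (LBINT s:{0..t}. (Bt *\<^sub>v (U s \<omega> - At)) $ i)" using drift i t by blast
      finally show "U t \<omega> $ i =
          (y0 + vec ?n (\<lambda>i. LBINT s:{0..t}. (Bt *\<^sub>v (U s \<omega> - At)) $ i) + \<sigma>t *\<^sub>v W t \<omega>) $ i"
        using i dims(4,5) by simp
    qed (use U_dim[OF t \<omega>] dims(5) in simp)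
    moreover have "(LBINT s:{0..t}. (Bt *\<^sub>v (vec_delete m (Y s \<omega>) - At)) $ i) =
        (LBINT s:{0..t}. (Bt *\<^sub>v (U s \<omega> - At)) $ i)" for i
      using \<omega> by (intro set_lebesgue_integral_cong) (auto simp: Y_delete)
    ultimately show "vec_delete m (Y t \<omega>) = y0 +
        vec ?n (\<lambda>i. LBINT s:{0..t}. (Bt *\<^sub>v (vec_delete m (Y s \<omega>) - At)) $ i) + \<sigma>t *\<^sub>v W t \<omega>"
      using Y_delete[OF t \<omega>] by simp
  qed
  moreover have "vec_adapted_cadlag M F ?n (\<lambda>t \<omega>. vec_delete m (Y t \<omega>))"
    using usual _ U_reg by (rule vec_adapted_cadlag_cong) (simp add: Y_delete)
  ultimately show ?thesis by (simp add: ou_solution_def)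
qed

end
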